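(* The class $\mathcal{ME}$ of modularly extended matroids coincides with the smallest class of simple matroids which contains all supersolvable simple matroids and is closed under taking modular joins over round flats (i.e., if $M=P_X(M_1,M_2)$ is a modular join over a round flat $X$ and $M_1,M_2$ lie in the class, then so does $M$).
   Context: All matroids are finite. For a simple matroid $M$ on ground set $E$ with rank function $r$, flats ordered by inclusion form the lattice $L(M)$, with $X\vee Y=\mathrm{cl}(X\cup Y)$. A coatom is a flat of rank $r(E)-1$. A flat $X$ is modular if $r(X)+r(Y)=r(X\cap Y)+r(X\vee Y)$ for every flat $Y$. $M|X$ denotes restriction. A simple matroid is supersolvable if it has a maximal chain of flats $\varnothing=X_0\subsetneq X_1\subsetneq\dots\subsetneq X_{r(E)}=E$ consisting of modular flats. A simple matroid $M$ is a modular join if $E=E_1\cup E_2$ for two proper modular flats $E_1,E_2$; then one writes $M=P_X(M_1,M_2)$ with $M_i=M|E_i$ and $X=E_1\cap E_2$ (modular join over $X$). A matroid is round if its ground set is not the union of two proper flats; a flat $S$ is round if $M|S$ is round. $\mathcal{ME}$ is the smallest class of simple matroids such that: (i) the empty matroid is in $\mathcal{ME}$; (ii) if a simple matroid $M$ has a modular coatom $X$ with $M|X\in\mathcal{ME}$, then $M\in\mathcal{ME}$; (iii) if $M$ is a modular join $P_X(M_1,M_2)$ over a round flat $X$ with $M_1,M_2\in\mathcal{ME}$, then $M\in\mathcal{ME}$. *)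

theory Defs
  imports Main
begin

text \<open>
  A value of the record type is only a ground set with a family of subsets; the matroid axioms are
  the predicate \<open>is_matroid\<close>.  Since \<open>indep\<close> is false outside the ground set, equality of records
  is equality of matroids.
\<close>

record 'a matroid =
  ground :: "'a set"
  indep :: "'a set \<Rightarrow> bool"

definition is_matroid :: "'a matroid \<Rightarrow> bool" where
  "is_matroid M \<longleftrightarrow>
     finite (ground M) \<and>
     (\<forall>I. indep M I \<longrightarrow> I \<subseteq> ground M) \<and>
     indep M {} \<and>
     (\<forall>I J. indep M J \<and> I \<subseteq> J \<longrightarrow> indep M I) \<and>
     (\<forall>I J. indep M I \<and> indep M J \<and> card I < card J \<longrightarrow> (\<exists>e\<in>J - I. indep M (insert e I)))"

text \<open>The case \<open>x = y\<close> below excludes loops.\<close>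

definition simple_matroid :: "'a matroid \<Rightarrow> bool" where
  "simple_matroid M \<longleftrightarrow> is_matroid M \<and> (\<forall>x\<in>ground M. \<forall>y\<in>ground M. indep M {x, y})"

definition empty_matroid :: "'a matroid" where
  "empty_matroid = \<lparr>ground = {}, indep = (\<lambda>I. I = {})\<rparr>"

definition restrict_matroid :: "'a matroid \<Rightarrow> 'a set \<Rightarrow> 'a matroid" where
  "restrict_matroid M X = \<lparr>ground = X, indep = (\<lambda>I. I \<subseteq> X \<and> indep M I)\<rparr>"

definition rk :: "'a matroid \<Rightarrow> 'a set \<Rightarrow> nat" where
  "rk M X = Max {card I |I. I \<subseteq> X \<and> indep M I}"

definition cl :: "'a matroid \<Rightarrow> 'a set \<Rightarrow> 'a set" where
  "cl M X = {e \<in> ground M. rk M (insert e X) = rk M X}"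

definition flat :: "'a matroid \<Rightarrow> 'a set \<Rightarrow> bool" where
  "flat M X \<longleftrightarrow> X \<subseteq> ground M \<and> cl M X = X"

definition proper_flat :: "'a matroid \<Rightarrow> 'a set \<Rightarrow> bool" where
  "proper_flat M X \<longleftrightarrow> flat M X \<and> X \<noteq> ground M"

definition coatom :: "'a matroid \<Rightarrow> 'a set \<Rightarrow> bool" where
  "coatom M X \<longleftrightarrow> flat M X \<and> rk M X + 1 = rk M (ground M)"

definition modular_flat :: "'a matroid \<Rightarrow> 'a set \<Rightarrow> bool" where
  "modular_flat M X \<longleftrightarrow>
     flat M X \<and> (\<forall>Y. flat M Y \<longrightarrow> rk M X + rk M Y = rk M (X \<inter> Y) + rk M (cl M (X \<union> Y)))"

text \<open>A strict chain of flats with \<open>rk M (ground M)\<close> steps is automatically maximal.\<close>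

definition supersolvable :: "'a matroid \<Rightarrow> bool" where
  "supersolvable M \<longleftrightarrow>
     simple_matroid M \<and>
     (\<exists>X :: nat \<Rightarrow> 'a set.
        X 0 = {} \<and> X (rk M (ground M)) = ground M \<and>
        (\<forall>i < rk M (ground M). X i \<subset> X (Suc i)) \<and>
        (\<forall>i \<le> rk M (ground M). modular_flat M (X i)))"

definition round_matroid :: "'a matroid \<Rightarrow> bool" where
  "round_matroid M \<longleftrightarrow> \<not> (\<exists>F G. proper_flat M F \<and> proper_flat M G \<and> ground M = F \<union> G)"

definition round_flat :: "'a matroid \<Rightarrow> 'a set \<Rightarrow> bool" where
  "round_flat M S \<longleftrightarrow> flat M S \<and> round_matroid (restrict_matroid M S)"

text \<open>\<open>modular_join M X M1 M2\<close> renders $M = P_X(M_1, M_2)$.\<close>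

definition modular_join :: "'a matroid \<Rightarrow> 'a set \<Rightarrow> 'a matroid \<Rightarrow> 'a matroid \<Rightarrow> bool" where
  "modular_join M X M1 M2 \<longleftrightarrow>
     simple_matroid M \<and>
     (\<exists>E1 E2. proper_flat M E1 \<and> modular_flat M E1 \<and>
              proper_flat M E2 \<and> modular_flat M E2 \<and>
              ground M = E1 \<union> E2 \<and> X = E1 \<inter> E2 \<and>
              M1 = restrict_matroid M E1 \<and> M2 = restrict_matroid M E2)"

text \<open>
  Both classes are formed inside one element type.  This loses nothing: every rule derives
  membership of a matroid from membership of restrictions of it.
\<close>

inductive_set ME :: "'a matroid set" where
  empty: "empty_matroid \<in> ME"
| coatom: "\<lbrakk>simple_matroid M; coatom M X; modular_flat M X; restrict_matroid M X \<in> ME\<rbrakk>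
    \<Longrightarrow> M \<in> ME"
| join: "\<lbrakk>modular_join M X M1 M2; round_flat M X; M1 \<in> ME; M2 \<in> ME\<rbrakk> \<Longrightarrow> M \<in> ME"

inductive_set supersolvable_join_closure :: "'a matroid set" where
  supersolvable: "supersolvable M \<Longrightarrow> M \<in> supersolvable_join_closure"
| join: "\<lbrakk>modular_join M X M1 M2; round_flat M X;
      M1 \<in> supersolvable_join_closure; M2 \<in> supersolvable_join_closure\<rbrakk>
    \<Longrightarrow> M \<in> supersolvable_join_closure"

end

theory Submission
  imports Defs
begin

text \<open>
  The substantial inclusion says that the join closure is stable under modular coatom extensions.
  Let $X$ be a modular coatom of $M$ whose restriction is a modular join of $F_1$ and $F_2$ over a
  round flat, and fix a point $e \notin X$.  Every further point $f \notin X$ has a projection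
  from $e$ to $X$, a point common to $X$ and the line $ef$.  If some projection lay outside $F_1$
  and another one outside $F_2$, the line through them would contain a point of $X$ that is on the
  line joining the two projected points; that point lies in $F_1$ or $F_2$ and drags both
  projections into it.  So one of the two flats, say $F_1$, contains all projections.  Then
  $G = \mathrm{cl}(F_1 \cup e)$ contains all points outside $X$, is a modular flat with
  $G \cap X = F_1$, and $M$ is the modular join of $G$ and $F_2$ over the old flat
  $F_1 \cap F_2$; here $F_1$ is a modular coatom of $M|G$, which makes induction apply.
\<close>

section \<open>Rank, closure and flats\<close>

locale finite_matroid =
  fixes M :: "'a matroid"
  assumes is_matroid: "is_matroid M"
begin

lemma finite_ground: "finite (ground M)"
  and indep_subset: "indep M I \<Longrightarrow> I \<subseteq> ground M"
  and indep_empty: "indep M {}"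
  and indep_mono: "indep M J \<Longrightarrow> I \<subseteq> J \<Longrightarrow> indep M I"
  and indep_augment: "indep M I \<Longrightarrow> indep M J \<Longrightarrow> card I < card J \<Longrightarrow> \<exists>e\<in>J - I. indep M (insert e I)"
  using is_matroid unfolding is_matroid_def by blast+

lemma finite_indep: "indep M I \<Longrightarrow> finite I"
  using finite_ground finite_subset indep_subset by blast

lemma finite_rk_set: "finite {card I |I. I \<subseteq> X \<and> indep M I}"
proof -
  have "{card I |I. I \<subseteq> X \<and> indep M I} \<subseteq> card ` Pow (ground M)"
    using indep_subset by auto
  then show ?thesis
    using finite_ground finite_subset by blast
qed

lemma card_le_rk: "indep M I \<Longrightarrow> I \<subseteq> X \<Longrightarrow> card I \<le> rk M X"
  unfolding rk_def by (rule Max_ge[OF finite_rk_set]) auto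

lemma rk_attained: obtains I where "indep M I" "I \<subseteq> X" "card I = rk M X"
proof -
  have "{card I |I. I \<subseteq> X \<and> indep M I} \<noteq> {}"
    using indep_empty by auto
  then have "rk M X \<in> {card I |I. I \<subseteq> X \<and> indep M I}"
    unfolding rk_def by (rule Max_in[OF finite_rk_set])
  then show ?thesis
    using that by auto
qed

lemma rk_mono: "X \<subseteq> Y \<Longrightarrow> rk M X \<le> rk M Y"
  by (metis card_le_rk rk_attained subset_trans)

lemma rk_empty [simp]: "rk M {} = 0"
  by (metis card.empty rk_attained subset_empty)

lemma extend_to_basis:
  assumes "indep M I" "I \<subseteq> X"
  obtains B where "indep M B" "I \<subseteq> B" "B \<subseteq> X" "card B = rk M X"
  using assms
proof (induction "rk M X - card I" arbitrary: I thesis rule: less_induct)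
  case less
  show ?case
  proof (cases "card I = rk M X")
    case True
    then show ?thesis using less.prems by blast
  next
    case False
    then have lt: "card I < rk M X"
      using card_le_rk less.prems by (simp add: order_less_le)
    obtain J where J: "indep M J" "J \<subseteq> X" "card J = rk M X"
      using rk_attained .
    then obtain e where e: "e \<in> J - I" "indep M (insert e I)"
      using indep_augment less.prems lt by metis
    have "card (insert e I) = Suc (card I)"
      using e finite_indep less.prems by auto
    then have "rk M X - card (insert e I) < rk M X - card I"
      using lt by simp
    then show ?thesis
      using less.hyps[OF _ _ e(2)] less.prems e J by (metis Diff_iff insert_subset subsetD)
  qed
qed

text \<open>A basis of the intersection extends to a basis \<open>B\<close> of the union. The parts
  of \<open>B\<close> in \<open>X\<close> and in \<open>Y\<close> are independent, cover
  \<open>B\<close>, and overlap in at least the chosen basis.\<close>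

lemma rk_submodular: "rk M (X \<union> Y) + rk M (X \<inter> Y) \<le> rk M X + rk M Y"
proof -
  obtain I where I: "indep M I" "I \<subseteq> X \<inter> Y" "card I = rk M (X \<inter> Y)"
    using rk_attained .
  then obtain B where B: "indep M B" "I \<subseteq> B" "B \<subseteq> X \<union> Y" "card B = rk M (X \<union> Y)"
    using extend_to_basis[of I "X \<union> Y"] by blast
  have fin: "finite B"
    using B finite_indep by blast
  have "I \<subseteq> B \<inter> X \<inter> (B \<inter> Y)"
    using I B by blast
  then have "card I \<le> card (B \<inter> X \<inter> (B \<inter> Y))"
    using fin by (intro card_mono) auto
  moreover have "card (B \<inter> X) + card (B \<inter> Y) = card (B \<inter> X \<union> B \<inter> Y) + card (B \<inter> X \<inter> (B \<inter> Y))"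
    using fin by (intro card_Un_Int) auto
  moreover have "B \<inter> X \<union> B \<inter> Y = B"
    using B by blast
  moreover have "card (B \<inter> X) \<le> rk M X" "card (B \<inter> Y) \<le> rk M Y"
    using B indep_mono by (auto intro!: card_le_rk)
  ultimately show ?thesis
    using I B by simp
qed

lemma rk_le_card: "finite X \<Longrightarrow> rk M X \<le> card X"
  by (metis card_mono rk_attained)

lemma rk_insert_le: "rk M (insert e X) \<le> Suc (rk M X)"
  using rk_submodular[of X "{e}"] rk_le_card[of "{e}"] by simp

text \<open>Were the rank larger, augmentation would extend a basis of \<open>X\<close> by a single
  element of \<open>Y\<close>, and that element would already raise the rank of
  \<open>X\<close>.\<close>

lemma rk_eqI:
  assumes "X \<subseteq> Y" "\<And>e. e \<in> Y \<Longrightarrow> rk M (insert e X) = rk M X"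
  shows "rk M Y = rk M X"
proof (rule ccontr)
  assume "rk M Y \<noteq> rk M X"
  then have lt: "rk M X < rk M Y"
    using rk_mono[OF assms(1)] by simp
  obtain B where B: "indep M B" "B \<subseteq> X" "card B = rk M X"
    using rk_attained .
  obtain J where J: "indep M J" "J \<subseteq> Y" "card J = rk M Y"
    using rk_attained .
  obtain e where e: "e \<in> J - B" "indep M (insert e B)"
    using indep_augment[OF B(1) J(1)] B J lt by auto
  have "card (insert e B) \<le> rk M (insert e X)"
    using e B by (intro card_le_rk) auto
  then show False
    using e assms(2)[of e] B J finite_indep[OF B(1)] by auto
qed

section \<open>The closure operator and its flats\<close>

lemma cl_subset_ground: "cl M X \<subseteq> ground M"
  by (auto simp: cl_def)

lemma subset_cl: "X \<subseteq> ground M \<Longrightarrow> X \<subseteq> cl M X"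
  by (auto simp: cl_def insert_absorb)

text \<open>An element that adds no rank to \<open>X\<close> adds none to a larger set, by
  submodularity, so the whole closure can be added to \<open>Y\<close> at no cost. Taking
  \<open>Y\<close> empty gives the rank of a closure.\<close>

lemma rk_Un_cl:
  assumes "X \<subseteq> ground M"
  shows "rk M (Y \<union> cl M X) = rk M (Y \<union> X)"
proof (rule rk_eqI)
  show "Y \<union> X \<subseteq> Y \<union> cl M X"
    using subset_cl[OF assms] by blast
  fix e assume e: "e \<in> Y \<union> cl M X"
  show "rk M (insert e (Y \<union> X)) = rk M (Y \<union> X)"
  proof (cases "e \<in> Y \<union> X")
    case True
    then show ?thesis by (simp add: insert_absorb)
  next
    case False
    then have "rk M (insert e X) = rk M X"
      using e by (auto simp: cl_def)
    moreover have "insert e X \<union> (Y \<union> X) = insert e (Y \<union> X)"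
      "insert e X \<inter> (Y \<union> X) = X"
      using False by auto
    ultimately have "rk M (insert e (Y \<union> X)) \<le> rk M (Y \<union> X)"
      using rk_submodular[of "insert e X" "Y \<union> X"] by simp
    then show ?thesis
      using rk_mono[of "Y \<union> X" "insert e (Y \<union> X)"] by fastforce
  qed
qed

lemma rk_cl: "X \<subseteq> ground M \<Longrightarrow> rk M (cl M X) = rk M X"
  using rk_Un_cl[of X "{}"] by simp

lemma flat_cl: "X \<subseteq> ground M \<Longrightarrow> flat M (cl M X)"
proof -
  assume X: "X \<subseteq> ground M"
  have "rk M (insert e (cl M X)) = rk M (insert e X)" for e
    using rk_Un_cl[OF X, of "{e}"] by simp
  then have "cl M (cl M X) = cl M X"
    using rk_cl[OF X] by (metis (no_types, lifting) Collect_cong cl_def)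
  then show ?thesis
    by (simp add: flat_def cl_subset_ground)
qed

lemma cl_mono:
  assumes "X \<subseteq> Y" "Y \<subseteq> ground M"
  shows "cl M X \<subseteq> cl M Y"
proof
  fix e assume e: "e \<in> cl M X"
  have "rk M (Y \<union> cl M X) = rk M Y"
    using rk_Un_cl[of X Y] assms by (simp add: Un_absorb2)
  moreover have "rk M (insert e Y) \<le> rk M (Y \<union> cl M X)" "rk M Y \<le> rk M (insert e Y)"
    using e by (auto intro!: rk_mono)
  ultimately show "e \<in> cl M Y"
    using e by (simp add: cl_def)
qed

lemma flat_subset_ground: "flat M F \<Longrightarrow> F \<subseteq> ground M"
  by (simp add: flat_def)

lemma cl_least: "flat M F \<Longrightarrow> X \<subseteq> F \<Longrightarrow> cl M X \<subseteq> F"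
  using cl_mono[of X F] by (simp add: flat_def)

lemma flat_Int:
  assumes "flat M F" "flat M G"
  shows "flat M (F \<inter> G)"
proof -
  have "F \<inter> G \<subseteq> ground M"
    using assms flat_subset_ground by blast
  then show ?thesis
    unfolding flat_def
    using cl_least[of F "F \<inter> G"] cl_least[of G "F \<inter> G"] subset_cl[of "F \<inter> G"] assms by blast
qed

lemma rk_insert_flat: "flat M F \<Longrightarrow> e \<in> ground M \<Longrightarrow> e \<notin> F \<Longrightarrow> rk M (insert e F) = Suc (rk M F)"
  using rk_insert_le[of e F] rk_mono[of F "insert e F"]
  by (fastforce simp: flat_def cl_def)

lemma rk_strict_mono:
  assumes "flat M F" "F \<subset> G" "G \<subseteq> ground M"
  shows "rk M F < rk M G"
proof -
  obtain e where e: "e \<in> G" "e \<notin> F"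
    using assms by blast
  then have "rk M (insert e F) = Suc (rk M F)"
    using rk_insert_flat assms by blast
  moreover have "rk M (insert e F) \<le> rk M G"
    using e assms by (intro rk_mono) auto
  ultimately show ?thesis by simp
qed

lemma flat_ground: "flat M (ground M)"
  using subset_cl[of "ground M"] cl_subset_ground by (auto simp: flat_def)

text \<open>Counting ranks over \<open>A\<close>: the point \<open>f\<close> alone gains one, and
  \<open>e\<close> and \<open>f\<close> together gain at most one, so \<open>e\<close> adds nothing
  after \<open>f\<close>.\<close>

lemma cl_exchange:
  assumes "A \<subseteq> ground M" "e \<in> ground M" "f \<in> cl M (insert e A)" "f \<notin> cl M A"
  shows "e \<in> cl M (insert f A)"
proof -
  have f: "f \<in> ground M"
    using assms cl_subset_ground by blast
  have "rk M (insert f (insert e A)) = rk M (insert e A)"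
    using assms(3) by (simp add: cl_def)
  moreover have "rk M (insert f A) \<noteq> rk M A"
    using assms f by (simp add: cl_def)
  moreover have "rk M A \<le> rk M (insert f A)" "rk M (insert f A) \<le> rk M (insert e (insert f A))"
    by (auto intro!: rk_mono)
  moreover have "rk M (insert e A) \<le> Suc (rk M A)"
    by (rule rk_insert_le)
  ultimately have "rk M (insert e (insert f A)) = rk M (insert f A)"
    by (simp add: insert_commute)
  then show ?thesis
    using assms by (simp add: cl_def)
qed

section \<open>Modular flats\<close>

text \<open>Submodularity gives the reverse inequality and closure keeps the rank, so a single
  inequality free of closures has to be checked.\<close>

lemma modular_flat_iff:
  "modular_flat M X \<longleftrightarrow>
     flat M X \<and> (\<forall>Y. flat M Y \<longrightarrow> rk M X + rk M Y \<le> rk M (X \<inter> Y) + rk M (X \<union> Y))"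
proof -
  have "rk M (cl M (X \<union> Y)) = rk M (X \<union> Y)" if "flat M X" "flat M Y" for Y
    using that flat_subset_ground by (simp add: rk_cl)
  moreover have "rk M (X \<inter> Y) + rk M (X \<union> Y) \<le> rk M X + rk M Y" for Y
    using rk_submodular[of X Y] by simp
  ultimately show ?thesis
    unfolding modular_flat_def by (metis order_antisym order_refl)
qed

lemma modular_flatD:
  assumes "modular_flat M X" "flat M Y"
  shows "rk M X + rk M Y = rk M (X \<inter> Y) + rk M (X \<union> Y)"
  using assms rk_submodular[of X Y] unfolding modular_flat_iff by (simp add: order_antisym)

lemma modular_flat_ground: "modular_flat M (ground M)"
proof -
  have "ground M \<inter> Y = Y" "ground M \<union> Y = ground M" if "flat M Y" for Y
    using that flat_subset_ground by auto
  then show ?thesis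
    by (simp add: modular_flat_iff flat_ground)
qed

section \<open>Restriction to a flat\<close>

lemma finite_matroid_restrict:
  assumes "X \<subseteq> ground M"
  shows "finite_matroid (restrict_matroid M X)"
proof -
  have "\<exists>e\<in>J - I. e \<in> X \<and> indep M (insert e I)"
    if "indep M I" "indep M J" "J \<subseteq> X" "card I < card J" for I J
    using indep_augment[OF that(1,2,4)] that(3) by blast
  moreover have "finite X"
    using assms finite_ground finite_subset by blast
  ultimately show ?thesis
    using indep_empty
    by (auto simp: finite_matroid_def is_matroid_def restrict_matroid_def intro: indep_mono)
qed

lemma rk_restrict: "Y \<subseteq> X \<Longrightarrow> rk (restrict_matroid M X) Y = rk M Y"
proof -
  assume "Y \<subseteq> X"
  then have "I \<subseteq> Y \<and> I \<subseteq> X \<and> indep M I \<longleftrightarrow> I \<subseteq> Y \<and> indep M I" for I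
    by blast
  then show ?thesis
    by (simp add: rk_def restrict_matroid_def)
qed

lemma cl_restrict:
  assumes "flat M X" "Y \<subseteq> X"
  shows "cl (restrict_matroid M X) Y = cl M Y"
proof -
  have "ground (restrict_matroid M X) = X"
    by (simp add: restrict_matroid_def)
  then have "cl (restrict_matroid M X) Y = {e \<in> X. rk M (insert e Y) = rk M Y}"
    using assms by (auto simp: cl_def rk_restrict)
  also have "\<dots> = cl M Y"
    using cl_least[OF assms] flat_subset_ground[OF assms(1)] unfolding cl_def by blast
  finally show ?thesis .
qed

lemma flat_restrict_iff: "flat M X \<Longrightarrow> flat (restrict_matroid M X) Y \<longleftrightarrow> flat M Y \<and> Y \<subseteq> X"
  using cl_restrict[of X Y] flat_subset_ground[of X]
  by (auto simp: flat_def restrict_matroid_def)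

lemma modular_flat_restrict_iff:
  assumes "flat M X"
  shows "modular_flat (restrict_matroid M X) Z \<longleftrightarrow>
    flat M Z \<and> Z \<subseteq> X \<and>
    (\<forall>Y. flat M Y \<and> Y \<subseteq> X \<longrightarrow> rk M Z + rk M Y \<le> rk M (Z \<inter> Y) + rk M (Z \<union> Y))"
proof -
  interpret R: finite_matroid "restrict_matroid M X"
    using finite_matroid_restrict assms flat_subset_ground by blast
  have "rk (restrict_matroid M X) (Z \<inter> Y) = rk M (Z \<inter> Y) \<and>
        rk (restrict_matroid M X) (Z \<union> Y) = rk M (Z \<union> Y)" if "Y \<subseteq> X" "Z \<subseteq> X" for Y
    using that by (simp add: rk_restrict le_infI1)
  then show ?thesis
    unfolding R.modular_flat_iff flat_restrict_iff[OF assms] by (auto simp: rk_restrict)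
qed

lemma modular_flat_restrict:
  "flat M X \<Longrightarrow> modular_flat M Z \<Longrightarrow> Z \<subseteq> X \<Longrightarrow> modular_flat (restrict_matroid M X) Z"
  by (simp add: modular_flat_restrict_iff modular_flat_iff)

text \<open>Against a flat \<open>Y\<close>, modularity of \<open>Z\<close> inside \<open>X\<close>
  is used for \<open>X \<inter> Y\<close>, and modularity of \<open>X\<close> both for
  \<open>Y\<close> and for the join \<open>W\<close> of \<open>Z\<close> and \<open>Y\<close>. As
  \<open>X \<union> W\<close> and \<open>X \<union> Y\<close> have the same rank, the rank gained
  from \<open>Y\<close> to \<open>W\<close> equals that gained from \<open>X \<inter> Y\<close> to
  \<open>X \<inter> W\<close>.\<close>

lemma modular_flat_trans:
  assumes X: "modular_flat M X" and Z: "modular_flat (restrict_matroid M X) Z"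
  shows "modular_flat M Z"
proof -
  have fX: "flat M X"
    using X by (simp add: modular_flat_def)
  have Z': "flat M Z" "Z \<subseteq> X"
    and mod: "\<And>Y. flat M Y \<Longrightarrow> Y \<subseteq> X \<Longrightarrow> rk M Z + rk M Y \<le> rk M (Z \<inter> Y) + rk M (Z \<union> Y)"
    using Z modular_flat_restrict_iff[OF fX] by auto
  have "rk M Z + rk M Y \<le> rk M (Z \<inter> Y) + rk M (Z \<union> Y)" if Y: "flat M Y" for Y
  proof -
    define W where "W = cl M (Z \<union> Y)"
    have sub: "Z \<union> Y \<subseteq> ground M"
      using Z' Y flat_subset_ground by blast
    have W: "flat M W" "Z \<union> Y \<subseteq> W" "rk M W = rk M (Z \<union> Y)"
      unfolding W_def using flat_cl[OF sub] subset_cl[OF sub] rk_cl[OF sub] by simp_all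
    have "Z \<inter> (X \<inter> Y) = Z \<inter> Y"
      using Z' by blast
    then have 1: "rk M Z + rk M (X \<inter> Y) \<le> rk M (Z \<inter> Y) + rk M (Z \<union> X \<inter> Y)"
      using mod[of "X \<inter> Y"] flat_Int[OF fX Y] by simp
    have 2: "rk M X + rk M Y = rk M (X \<inter> Y) + rk M (X \<union> Y)"
      using modular_flatD[OF X Y] .
    have "rk M (X \<union> W) = rk M (X \<union> (Z \<union> Y))"
      unfolding W_def by (rule rk_Un_cl[OF sub])
    also have "X \<union> (Z \<union> Y) = X \<union> Y"
      using Z' by blast
    finally have 3: "rk M X + rk M W = rk M (X \<inter> W) + rk M (X \<union> Y)"
      using modular_flatD[OF X W(1)] by simp
    have "rk M (Z \<union> X \<inter> Y) \<le> rk M (X \<inter> W)"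
      using Z' W by (intro rk_mono) auto
    then show ?thesis
      using 1 2 3 W by simp
  qed
  then show ?thesis
    using Z' by (simp add: modular_flat_iff)
qed

end

lemma restrict_restrict:
  "Z \<subseteq> X \<Longrightarrow> restrict_matroid (restrict_matroid M X) Z = restrict_matroid M Z"
  by (auto simp: restrict_matroid_def fun_eq_iff)

lemma ground_restrict [simp]: "ground (restrict_matroid M X) = X"
  by (simp add: restrict_matroid_def)

lemma simple_matroid_finite_matroid: "simple_matroid M \<Longrightarrow> finite_matroid M"
  by (simp add: simple_matroid_def finite_matroid_def)

lemma simple_matroid_restrict:
  assumes "simple_matroid M" "X \<subseteq> ground M"
  shows "simple_matroid (restrict_matroid M X)"
proof -
  interpret finite_matroid M
    using assms simple_matroid_finite_matroid by blast
  have "is_matroid (restrict_matroid M X)"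
    using finite_matroid_restrict[OF assms(2)] by (simp add: finite_matroid_def)
  then show ?thesis
    using assms unfolding simple_matroid_def by (auto simp: restrict_matroid_def)
qed

section \<open>Modular coatoms\<close>

locale modular_coatom_matroid = finite_matroid +
  fixes X :: "'a set"
  assumes simple: "simple_matroid M"
    and coatom: "coatom M X"
    and modular: "modular_flat M X"
begin

lemma flat_X: "flat M X"
  using modular by (simp add: modular_flat_def)

text \<open>A point outside \<open>X\<close> lifts \<open>X\<close> to full rank because
  \<open>X\<close> has corank one; modularity then converts the rank of the union into that of the
  intersection.\<close>

lemma rk_flat_not_below:
  assumes "flat M Y" "y \<in> Y" "y \<notin> X"
  shows "rk M Y = Suc (rk M (Y \<inter> X))"
proof -
  have "rk M (insert y X) = Suc (rk M X)"
    using assms flat_subset_ground by (intro rk_insert_flat[OF flat_X]) auto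
  moreover have "rk M (insert y X) \<le> rk M (X \<union> Y)" "rk M (X \<union> Y) \<le> rk M (ground M)"
    using assms flat_subset_ground flat_X by (auto intro!: rk_mono)
  ultimately have "rk M (X \<union> Y) = Suc (rk M X)"
    using coatom by (simp add: coatom_def)
  then show ?thesis
    using modular_flatD[OF modular assms(1)] by (simp add: Int_commute)
qed

section \<open>Points, lines and projection onto the coatom from an outside point\<close>

lemma rk_pair: "x \<in> ground M \<Longrightarrow> y \<in> ground M \<Longrightarrow> x \<noteq> y \<Longrightarrow> rk M {x, y} = 2"
  using simple card_le_rk[of "{x, y}" "{x, y}"] rk_le_card[of "{x, y}"]
  by (simp add: simple_matroid_def)

lemma cl_singleton:
  assumes "x \<in> ground M"
  shows "cl M {x} = {x}"
proof -
  have "y = x" if "y \<in> cl M {x}" for y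
    using that assms rk_pair[of y x] rk_le_card[of "{x}"] by (force simp: cl_def)
  then show ?thesis
    using assms subset_cl[of "{x}"] by auto
qed

text \<open>The line through \<open>e\<close> and \<open>f\<close> has rank 2, so its trace on
  \<open>X\<close> has rank 1 and cannot be empty.\<close>

lemma projection_exists:
  assumes "e \<in> ground M" "e \<notin> X" "f \<in> ground M" "e \<noteq> f"
  obtains p where "p \<in> cl M {e, f}" "p \<in> X"
proof -
  have sub: "{e, f} \<subseteq> ground M"
    using assms by simp
  have "2 = Suc (rk M (cl M {e, f} \<inter> X))"
    using rk_flat_not_below[of "cl M {e, f}" e] flat_cl[OF sub] subset_cl[OF sub] rk_cl[OF sub]
      rk_pair[of e f] assms by simp
  then have "cl M {e, f} \<inter> X \<noteq> {}"
    by (metis One_nat_def Suc_1 Suc_inject nat.distinct(1) rk_empty)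
  then show ?thesis
    using that by blast
qed

text \<open>Exchange applies because the closure of \<open>e\<close> is just \<open>e\<close>, which
  lies outside \<open>X\<close> and so differs from \<open>p\<close>.\<close>

lemma projection_sym:
  assumes "e \<in> ground M" "e \<notin> X" "f \<in> ground M" "p \<in> cl M {e, f}" "p \<in> X"
  shows "f \<in> cl M {e, p}"
proof -
  have "p \<notin> cl M {e}"
    using assms cl_singleton by auto
  then show ?thesis
    using cl_exchange[of "{e}" f p] assms by (simp add: insert_commute)
qed

lemma projection_unique:
  assumes "e \<in> ground M" "e \<notin> X" "f \<in> ground M"
    and "p \<in> cl M {e, f}" "p \<in> X" "q \<in> cl M {e, f}" "q \<in> X"
  shows "p = q"
proof (rule ccontr)
  assume ne: "p \<noteq> q"
  have sub: "{e, f} \<subseteq> ground M"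
    using assms by simp
  \<comment> \<open>The points \<open>e\<close> and \<open>f\<close> may coincide, so the rank is
    only bounded from above. This leaves at most rank 1 for the trace on \<open>X\<close>, too
    little for two points of a simple matroid.\<close>
  have "card {e, f} \<le> 2"
    by (simp add: card_insert_if)
  then have "rk M {e, f} \<le> 2"
    using rk_le_card[of "{e, f}"] by simp
  then have "rk M (cl M {e, f} \<inter> X) \<le> 1"
    using rk_flat_not_below[of "cl M {e, f}" e] flat_cl[OF sub] subset_cl[OF sub] rk_cl[OF sub]
      assms by simp
  moreover have "rk M {p, q} \<le> rk M (cl M {e, f} \<inter> X)"
    using assms by (intro rk_mono) auto
  moreover have "rk M {p, q} = 2"
    using rk_pair ne assms flat_subset_ground[OF flat_X] by blast
  ultimately show False by simp
qed

text \<open>The flat spanned by \<open>e\<close>, \<open>f\<close> and \<open>g\<close> meets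
  \<open>X\<close> in rank at most 2, so \<open>p\<close>, \<open>q\<close> and \<open>h\<close> are
  collinear. If \<open>q\<close> and \<open>h\<close> differ, their line stays in \<open>F\<close>
  and contains \<open>p\<close>. If they coincide, \<open>e\<close> lies on the line through
  \<open>f\<close> and \<open>g\<close>, and uniqueness of projections gives
  \<open>p = h\<close>.\<close>

lemma projections_same_side:
  assumes F: "flat M F"
    and e: "e \<in> ground M" "e \<notin> X" and f: "f \<in> ground M" "f \<notin> X" and g: "g \<in> ground M" "g \<notin> X"
    and p: "p \<in> cl M {e, f}" "p \<in> X" and q: "q \<in> cl M {e, g}" "q \<in> X" "q \<in> F"
    and h: "h \<in> cl M {f, g}" "h \<in> X" "h \<in> F"
  shows "p \<in> F"
proof (cases "q = h")
  case True
  have "e \<in> cl M {g, q}"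
    using projection_sym[of g e q] q g e by (simp add: insert_commute)
  moreover have "cl M {g, q} \<subseteq> cl M {f, g}"
    using True h f g by (intro cl_least flat_cl) (auto intro: subset_cl[THEN subsetD])
  ultimately have "e \<in> cl M {f, g}" by blast
  then have "cl M {e, f} \<subseteq> cl M {f, g}"
    using f g by (intro cl_least flat_cl) (auto intro: subset_cl[THEN subsetD])
  then have "p = h"
    using projection_unique[of f g p h] f g p h by blast
  then show ?thesis using h by simp
next
  case False
  have sub: "{e, f, g} \<subseteq> ground M"
    using e f g by simp
  have "card {e, f, g} \<le> 3"
    by (simp add: card_insert_if)
  then have "rk M {e, f, g} \<le> 3"
    using rk_le_card[of "{e, f, g}"] by simp
  then have le2: "rk M (cl M {e, f, g} \<inter> X) \<le> 2"
    using rk_flat_not_below[of "cl M {e, f, g}" e] flat_cl[OF sub] subset_cl[OF sub] rk_cl[OF sub] e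
    by simp
  have "cl M {e, f} \<subseteq> cl M {e, f, g}" "cl M {e, g} \<subseteq> cl M {e, f, g}" "cl M {f, g} \<subseteq> cl M {e, f, g}"
    by (rule cl_mono[OF _ sub]; simp)+
  then have "rk M {p, q, h} \<le> rk M (cl M {e, f, g} \<inter> X)"
    using p q h by (intro rk_mono) auto
  moreover have "rk M {q, h} = 2"
    using rk_pair[of q h] False q h flat_subset_ground[OF flat_X] by blast
  moreover have "rk M {q, h} \<le> rk M {p, q, h}"
    by (rule rk_mono) auto
  ultimately have "p \<in> cl M {q, h}"
    using le2 p flat_subset_ground[OF flat_X] by (auto simp: cl_def)
  then show ?thesis
    using cl_least[OF F, of "{q, h}"] q h by blast
qed

lemma outside_one_side:
  assumes F: "flat M F1" "flat M F2" "X = F1 \<union> F2" and e: "e \<in> ground M" "e \<notin> X"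
  shows "ground M - X \<subseteq> cl M (insert e F1) \<or> ground M - X \<subseteq> cl M (insert e F2)"
proof (rule ccontr)
  assume "\<not> ?thesis"
  then obtain f g where f: "f \<in> ground M" "f \<notin> X" "f \<notin> cl M (insert e F1)"
    and g: "g \<in> ground M" "g \<notin> X" "g \<notin> cl M (insert e F2)"
    by blast
  have sub: "insert e F1 \<subseteq> ground M" "insert e F2 \<subseteq> ground M"
    using F e flat_subset_ground by auto
  then have ef: "e \<noteq> f" "e \<noteq> g"
    using subset_cl f g by blast+
  obtain p where p: "p \<in> cl M {e, f}" "p \<in> X"
    using projection_exists e f ef by blast
  obtain q where q: "q \<in> cl M {e, g}" "q \<in> X"
    using projection_exists e g ef by blast
  have "p \<notin> F1"
    using projection_sym[of e f p] e f p cl_mono[of "{e, p}" "insert e F1"] sub by blast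
  moreover have "q \<notin> F2"
    using projection_sym[of e g q] e g q cl_mono[of "{e, q}" "insert e F2"] sub by blast
  ultimately have pq: "p \<in> F2" "p \<notin> F1" "q \<in> F1" "q \<notin> F2"
    using p q F by auto
  \<comment> \<open>Otherwise uniqueness of projections would give \<open>p = q\<close>, although
    \<open>F1\<close> contains only \<open>q\<close>.\<close>
  have "f \<noteq> g"
    using projection_unique[of e f p q] e f p q pq by blast
  then obtain h where h: "h \<in> cl M {f, g}" "h \<in> X"
    using projection_exists f g by blast
  \<comment> \<open>Points \<open>q\<close> and \<open>h\<close> in \<open>F1\<close> force
    \<open>p\<close> into \<open>F1\<close>; with \<open>f\<close> and \<open>g\<close> exchanged,
    \<open>p\<close> and \<open>h\<close> in \<open>F2\<close> force \<open>q\<close> into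
    \<open>F2\<close>.\<close>
  consider "h \<in> F1" | "h \<in> F2"
    using h F by blast
  then show False
  proof cases
    case 1
    then show False
      using projections_same_side[of F1 e f g p q h] F e f g p q h pq by blast
  next
    case 2
    then show False
      using projections_same_side[of F2 e g f q p h] F e f g p q h pq
      by (simp add: insert_commute)
  qed
qed

section \<open>The flat spanned by an outside point and the factor that contains all
  projections\<close>

context
  fixes F e
  assumes F: "modular_flat M F" "F \<subseteq> X" and e: "e \<in> ground M" "e \<notin> X"
    and outside: "ground M - X \<subseteq> cl M (insert e F)"
begin

lemma flat_extension: "flat M (cl M (insert e F))"
  and subset_extension: "insert e F \<subseteq> cl M (insert e F)"
  and rk_extension: "rk M (cl M (insert e F)) = Suc (rk M F)"
proof -
  have fF: "flat M F"
    using F by (simp add: modular_flat_def)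
  then have sub: "insert e F \<subseteq> ground M"
    using e flat_subset_ground by simp
  then show "flat M (cl M (insert e F))" "insert e F \<subseteq> cl M (insert e F)"
    using flat_cl[OF sub] subset_cl[OF sub] by simp_all
  show "rk M (cl M (insert e F)) = Suc (rk M F)"
    using rk_cl[OF sub] rk_insert_flat[OF fF, of e] e F by auto
qed

text \<open>\<open>F\<close> lies in the intersection, and both have rank one less than the
  extension, so the flat \<open>F\<close> cannot be strictly smaller.\<close>

lemma extension_Int: "cl M (insert e F) \<inter> X = F"
proof (rule ccontr)
  assume ne: "cl M (insert e F) \<inter> X \<noteq> F"
  have "rk M (cl M (insert e F) \<inter> X) = rk M F"
    using rk_flat_not_below[OF flat_extension, of e] subset_extension rk_extension e by simp
  moreover have "F \<subset> cl M (insert e F) \<inter> X"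
    using ne subset_extension F by blast
  ultimately show False
    using rk_strict_mono[of F "cl M (insert e F) \<inter> X"] F flat_subset_ground[OF flat_X]
    by (auto simp: modular_flat_def)
qed

text \<open>Cutting with \<open>X\<close> reduces the claim to modularity of \<open>F\<close>. For
  \<open>Y\<close> not below \<open>X\<close>, the extension, \<open>Y\<close> and their
  intersection each lose exactly one rank; for \<open>Y\<close> below \<open>X\<close>, only the
  extension does. In both cases the rank of the union drops by at least one.\<close>

lemma modular_flat_extension: "modular_flat M (cl M (insert e F))"
proof -
  let ?G = "cl M (insert e F)"
  have fF: "flat M F"
    using F by (simp add: modular_flat_def)
  \<comment> \<open>All of \<open>F \<union> Z\<close> stays inside the flat \<open>X\<close>, so
    the point \<open>y\<close> outside \<open>X\<close> adds one to its rank.\<close>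
  have Suc_rk: "Suc (rk M (F \<union> Z)) \<le> rk M (?G \<union> Y)" 
    if "flat M Z" "Z \<subseteq> X" "Z \<subseteq> Y" "y \<in> ground M" "y \<notin> X" "y \<in> ?G \<union> Y" "Y \<subseteq> ground M" for Z Y y
  proof -
    have sub: "F \<union> Z \<subseteq> ground M"
      using fF that flat_subset_ground by auto
    have "y \<notin> cl M (F \<union> Z)"
      using that F cl_least[OF flat_X, of "F \<union> Z"] by blast
    then have "Suc (rk M (cl M (F \<union> Z))) = rk M (insert y (cl M (F \<union> Z)))"
      using rk_insert_flat[OF flat_cl[OF sub]] that by simp
    also have "\<dots> = rk M (insert y (F \<union> Z))"
      using rk_Un_cl[OF sub, of "{y}"] by simp
    also have "\<dots> \<le> rk M (?G \<union> Y)"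
      using that subset_extension by (intro rk_mono) auto
    finally show ?thesis
      by (simp add: rk_cl[OF sub])
  qed
  have "rk M ?G + rk M Y \<le> rk M (?G \<inter> Y) + rk M (?G \<union> Y)" if Y: "flat M Y" for Y
  proof (cases "Y \<subseteq> X")
    case True
    then have "?G \<inter> Y = F \<inter> Y"
      using extension_Int by blast
    moreover have "Suc (rk M (F \<union> Y)) \<le> rk M (?G \<union> Y)"
      using Suc_rk[of Y Y e] Y True e subset_extension flat_subset_ground by auto
    ultimately show ?thesis
      using modular_flatD[OF F(1) Y] rk_extension by simp
  next
    case False
    then obtain y where y: "y \<in> Y" "y \<notin> X" by blast
    have yE: "y \<in> ground M"
      using y Y flat_subset_ground by blast
    have fYX: "flat M (Y \<inter> X)"
      using flat_Int[OF Y flat_X] .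
    have "rk M Y = Suc (rk M (Y \<inter> X))"
      using rk_flat_not_below[OF Y y] .
    \<comment> \<open>By \<open>outside\<close> the point \<open>y\<close> belongs to the extension,
      so the intersection is not below \<open>X\<close> either.\<close>
    moreover have "rk M (?G \<inter> Y) = Suc (rk M (?G \<inter> Y \<inter> X))"
      using rk_flat_not_below[OF flat_Int[OF flat_extension Y], of y] outside y yE by blast
    moreover have "?G \<inter> Y \<inter> X = F \<inter> (Y \<inter> X)"
      using extension_Int by blast
    moreover have "Suc (rk M (F \<union> Y \<inter> X)) \<le> rk M (?G \<union> Y)"
      using Suc_rk[of "Y \<inter> X" Y y] fYX y yE Y flat_subset_ground by auto
    ultimately show ?thesis
      using modular_flatD[OF F(1) fYX] rk_extension by simp
  qed
  then show ?thesis
    using flat_extension by (simp add: modular_flat_iff)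
qed

text \<open>Makes the induction hypothesis of \<open>closure_coatom\<close> applicable: it concerns
  every matroid that has the given factor as a modular coatom.\<close>

lemma extension_modular_coatom:
  "modular_coatom_matroid (restrict_matroid M (cl M (insert e F))) F"
proof -
  let ?G = "cl M (insert e F)"
  have fF: "flat M F"
    using F by (simp add: modular_flat_def)
  have sub: "F \<subseteq> ?G" "?G \<subseteq> ground M"
    using subset_extension cl_subset_ground by auto
  have "coatom (restrict_matroid M ?G) F"
    using fF sub rk_extension flat_restrict_iff[OF flat_extension]
    by (simp add: coatom_def rk_restrict)
  moreover have "modular_flat (restrict_matroid M ?G) F"
    using modular_flat_restrict[OF flat_extension F(1)] sub by simp
  ultimately show ?thesis
    using finite_matroid_restrict[OF sub(2)] simple_matroid_restrict[OF simple sub(2)]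
    by (simp add: modular_coatom_matroid_def modular_coatom_matroid_axioms_def)
qed

end

lemma modular_join_extension:
  assumes F: "proper_flat (restrict_matroid M X) F1" "modular_flat (restrict_matroid M X) F1"
      "proper_flat (restrict_matroid M X) F2" "modular_flat (restrict_matroid M X) F2"
    and X: "X = F1 \<union> F2" and e: "e \<in> ground M" "e \<notin> X"
    and outside: "ground M - X \<subseteq> cl M (insert e F1)"
  shows "modular_join M (F1 \<inter> F2) (restrict_matroid M (cl M (insert e F1))) (restrict_matroid M F2)"
proof -
  let ?G = "cl M (insert e F1)"
  have mod: "modular_flat M F1" "modular_flat M F2"
    using modular_flat_trans[OF modular] F by auto
  have sub: "F1 \<subset> X" "F2 \<subset> X"
    using F X by (auto simp: proper_flat_def)
  note hyps = mod(1) _ e outside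
  have Int: "?G \<inter> X = F1"
    using extension_Int hyps sub by blast
  have G: "modular_flat M ?G"
    using modular_flat_extension hyps sub by blast
  have XE: "X \<subseteq> ground M"
    using flat_subset_ground[OF flat_X] .
  \<comment> \<open>The extension meets \<open>X\<close> only in \<open>F1\<close>, and
    \<open>F2\<close> stays below \<open>X\<close>, so both sides of the new join are proper and the
    overlap is the old one.\<close>
  have "?G \<noteq> ground M" "F2 \<noteq> ground M"
    using Int sub XE by auto
  then have "proper_flat M ?G" "proper_flat M F2"
    using G mod by (auto simp: proper_flat_def modular_flat_def)
  moreover have "F1 \<subseteq> ?G"
    using Int by blast
  then have "ground M = ?G \<union> F2"
    using outside X XE cl_subset_ground by blast
  moreover have "F1 \<inter> F2 = ?G \<inter> F2"
    using Int sub by blast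
  ultimately show ?thesis
    unfolding modular_join_def using simple G mod by blast
qed

text \<open>The ground set is put on top of a modular chain of the restriction, whose members are
  modular in \<open>M\<close> by \<open>modular_flat_trans\<close>.\<close>

lemma supersolvable_extension:
  assumes "supersolvable (restrict_matroid M X)"
  shows "supersolvable M"
proof -
  let ?r = "rk M X"
  have XE: "X \<subset> ground M"
    using flat_subset_ground[OF flat_X] coatom by (auto simp: coatom_def)
  have r: "rk M (ground M) = Suc ?r"
    using coatom by (simp add: coatom_def)
  obtain C where C: "C 0 = {}" "C ?r = X" "\<And>i. i < ?r \<Longrightarrow> C i \<subset> C (Suc i)"
      "\<And>i. i \<le> ?r \<Longrightarrow> modular_flat (restrict_matroid M X) (C i)"
    using assms unfolding supersolvable_def by (auto simp: rk_restrict)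
  define D where "D = C(Suc ?r := ground M)"
  have "D i \<subset> D (Suc i)" if "i < Suc ?r" for i
    using C that XE by (cases "i = ?r") (auto simp: D_def)
  moreover have "modular_flat M (D i)" if "i \<le> Suc ?r" for i
    using that C(4) modular_flat_trans[OF modular] modular_flat_ground
    by (cases "i = Suc ?r") (auto simp: D_def)
  moreover have "D 0 = {}" "D (Suc ?r) = ground M"
    using C by (auto simp: D_def)
  ultimately show ?thesis
    unfolding supersolvable_def r using simple by blast
qed

end

section \<open>The two classes\<close>

lemma round_flat_restrict:
  assumes "finite_matroid M" "flat M X" "round_flat (restrict_matroid M X) S"
  shows "round_flat M S"
proof -
  interpret finite_matroid M by fact
  have "flat M S" "S \<subseteq> X"
    using assms(3) flat_restrict_iff[OF assms(2)] by (simp_all add: round_flat_def)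
  then show ?thesis
    using assms(3) restrict_restrict[of S X M] by (simp add: round_flat_def)
qed

text \<open>Induction on the derivation for the restriction, with \<open>M\<close> and
  \<open>X\<close> left free: in the join case the hypothesis is used for the restriction to
  \<open>cl M (insert e F1)\<close> with coatom \<open>F1\<close>, or likewise with
  \<open>F2\<close>.\<close>

lemma closure_coatom:
  assumes "restrict_matroid M X \<in> supersolvable_join_closure" "modular_coatom_matroid M X"
  shows "M \<in> supersolvable_join_closure"
  using assms
proof (induction "restrict_matroid M X" arbitrary: M X rule: supersolvable_join_closure.induct)
  case supersolvable
  then show ?case
    using modular_coatom_matroid.supersolvable_extension
      supersolvable_join_closure.supersolvable by blast
next
  case (join S M1 M2 M X)
  interpret modular_coatom_matroid M X by fact
  obtain F1 F2 where F: "proper_flat (restrict_matroid M X) F1" "modular_flat (restrict_matroid M X) F1"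
      "proper_flat (restrict_matroid M X) F2" "modular_flat (restrict_matroid M X) F2"
    and X: "X = F1 \<union> F2" and S: "S = F1 \<inter> F2"
    and M1: "M1 = restrict_matroid M F1" and M2: "M2 = restrict_matroid M F2"
    using join.hyps(1) unfolding modular_join_def
    by (metis Un_upper1 Un_upper2 ground_restrict restrict_restrict)
  have round: "round_flat M S"
    using round_flat_restrict join.hyps flat_X finite_matroid_axioms by blast
  have mod: "modular_flat M F1" "modular_flat M F2"
    using modular_flat_trans[OF modular] F by auto
  have "X \<noteq> ground M"
    using coatom by (auto simp: coatom_def)
  then obtain e where e: "e \<in> ground M" "e \<notin> X"
    using flat_subset_ground[OF flat_X] by blast
  have "ground M - X \<subseteq> cl M (insert e F1) \<or> ground M - X \<subseteq> cl M (insert e F2)"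
    using outside_one_side[of F1 F2 e] mod X e by (auto simp: modular_flat_def)
  then show ?case
  proof
    assume out: "ground M - X \<subseteq> cl M (insert e F1)"
    let ?G = "cl M (insert e F1)"
    have ext: "modular_coatom_matroid (restrict_matroid M ?G) F1"
      using extension_modular_coatom[OF mod(1) _ e out] X by blast
    have "F1 \<subseteq> ?G"
      using extension_Int[OF mod(1) _ e out] X by blast
    then have "restrict_matroid M ?G \<in> supersolvable_join_closure"
      using join.hyps(4)[of "restrict_matroid M ?G" F1] ext M1 by (simp add: restrict_restrict)
    moreover have "modular_join M S (restrict_matroid M ?G) M2"
      using modular_join_extension[OF F X e out] S M2 by simp
    ultimately show ?thesis
      using supersolvable_join_closure.join round join.hyps by blast
  next
    \<comment> \<open>The mirror case: the factors trade places, and the overlap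
      \<open>F2 \<inter> F1\<close> is again \<open>S\<close>.\<close>
    assume out: "ground M - X \<subseteq> cl M (insert e F2)"
    let ?G = "cl M (insert e F2)"
    have ext: "modular_coatom_matroid (restrict_matroid M ?G) F2"
      using extension_modular_coatom[OF mod(2) _ e out] X by blast
    have "F2 \<subseteq> ?G"
      using extension_Int[OF mod(2) _ e out] X by blast
    then have "restrict_matroid M ?G \<in> supersolvable_join_closure"
      using join.hyps(6)[of "restrict_matroid M ?G" F2] ext M2 by (simp add: restrict_restrict)
    moreover have "modular_join M S (restrict_matroid M ?G) M1"
      using modular_join_extension[OF F(3,4,1,2) _ e out] X S M1 by (simp add: Un_commute Int_commute)
    ultimately show ?thesis
      using supersolvable_join_closure.join round join.hyps by blast
  qed
qed

section \<open>Supersolvable matroids in both classes\<close>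

lemma supersolvable_empty: "supersolvable empty_matroid"
proof -
  have simple: "simple_matroid (empty_matroid :: 'a matroid)"
    by (auto simp: simple_matroid_def is_matroid_def empty_matroid_def)
  interpret finite_matroid "empty_matroid :: 'a matroid"
    using simple by (rule simple_matroid_finite_matroid)
  have "ground (empty_matroid :: 'a matroid) = {}"
    by (simp add: empty_matroid_def)
  \<comment> \<open>The rank is 0, so the constant chain has no strict step to satisfy.\<close>
  then show ?thesis
    using simple modular_flat_ground unfolding supersolvable_def by (intro conjI exI[of _ "\<lambda>_. {}"]) auto
qed

text \<open>The last but one member of the modular chain serves as \<open>X\<close>, and the chain
  cut off there witnesses supersolvability of the restriction.\<close>

lemma supersolvable_coatom:
  assumes ss: "supersolvable M" and r: "rk M (ground M) = Suc r"
  obtains X where "coatom M X" "modular_flat M X" "supersolvable (restrict_matroid M X)"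
proof -
  have simple: "simple_matroid M"
    using ss by (simp add: supersolvable_def)
  interpret finite_matroid M
    using simple by (rule simple_matroid_finite_matroid)
  obtain C where C: "C 0 = {}" "C (Suc r) = ground M" "\<And>i. i < Suc r \<Longrightarrow> C i \<subset> C (Suc i)"
      "\<And>i. i \<le> Suc r \<Longrightarrow> modular_flat M (C i)"
    using ss r unfolding supersolvable_def by auto
  have flatC: "flat M (C i)" if "i \<le> Suc r" for i
    using C(4)[OF that] by (simp add: modular_flat_def)
  have less: "rk M (C i) < rk M (C (Suc i))" if "i < Suc r" for i
    using rk_strict_mono[of "C i" "C (Suc i)"] flatC[of i] flatC[of "Suc i"] C(3) that
      flat_subset_ground by simp
  \<comment> \<open>Strict growth gives this lower bound; the final step up to rank
    \<open>Suc r\<close> then leaves exactly rank \<open>r\<close> for \<open>C r\<close>.\<close>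
  have "i \<le> rk M (C i)" if "i \<le> Suc r" for i
    using that
  proof (induction i)
    case (Suc i)
    then show ?case using less[of i] by simp
  qed simp
  then have rkC: "rk M (C r) = r"
    using less[of r] C(2) r by (simp add: order_antisym)
  have sub: "C i \<subseteq> C r" if "i \<le> r" for i
    using that
  proof (induction i rule: inc_induct)
    case (step n)
    then show ?case using C(3)[of n] by auto
  qed simp
  have "coatom M (C r)"
    using flatC[of r] rkC r by (simp add: coatom_def)
  moreover have "supersolvable (restrict_matroid M (C r))"
    unfolding supersolvable_def
  proof (intro conjI exI[of _ C])
    show "simple_matroid (restrict_matroid M (C r))"
      using simple_matroid_restrict[OF simple] flatC[of r] flat_subset_ground by simp
    show "\<forall>i\<le>rk (restrict_matroid M (C r)) (ground (restrict_matroid M (C r))).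
        modular_flat (restrict_matroid M (C r)) (C i)"
      using modular_flat_restrict[OF flatC[of r]] C(4) sub rkC by (simp add: rk_restrict)
  qed (use C rkC in \<open>simp_all add: rk_restrict\<close>)
  ultimately show ?thesis
    using that C(4)[of r] by simp
qed

lemma supersolvable_in_ME: "supersolvable M \<Longrightarrow> M \<in> ME"
proof (induction "rk M (ground M)" arbitrary: M)
  case 0
  \<comment> \<open>At rank 0 the chain has a single relevant index, where it equals both
    \<open>{}\<close> and the ground set.\<close>
  then have g: "ground M = {}"
    unfolding supersolvable_def by metis
  have "is_matroid M"
    using 0 by (simp add: supersolvable_def simple_matroid_def)
  then have "indep M = (\<lambda>I. I = {})"
    using g by (auto simp: is_matroid_def fun_eq_iff)
  then have "M = empty_matroid"
    using g by (simp add: empty_matroid_def)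
  then show ?case
    using ME.empty by simp
next
  case (Suc r)
  obtain X where X: "coatom M X" "modular_flat M X" "supersolvable (restrict_matroid M X)"
    using supersolvable_coatom[OF Suc.prems] Suc.hyps(2) by metis
  have simple: "simple_matroid M"
    using Suc.prems by (simp add: supersolvable_def)
  then interpret finite_matroid M
    by (rule simple_matroid_finite_matroid)
  have "r = rk (restrict_matroid M X) (ground (restrict_matroid M X))"
    using X(1) Suc.hyps(2) by (simp add: rk_restrict coatom_def)
  then show ?case
    using ME.coatom[OF simple X(1,2)] Suc.hyps(1) X(3) by blast
qed

theorem theorem1p9: "(ME :: 'a matroid set) = supersolvable_join_closure"
proof (intro equalityI subsetI)
  fix M :: "'a matroid"
  assume "M \<in> ME"
  then show "M \<in> supersolvable_join_closure"
  proof induction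
    case empty
    show ?case
      using supersolvable_empty supersolvable_join_closure.supersolvable by blast
  next
    \<comment> \<open>The substantial clause: the other two are a supersolvable base case and a join
      of the closure itself.\<close>
    case (coatom M X)
    then have "modular_coatom_matroid M X"
      using simple_matroid_finite_matroid
      by (simp add: modular_coatom_matroid_def modular_coatom_matroid_axioms_def)
    then show ?case
      using closure_coatom coatom.IH by blast
  next
    case join
    then show ?case
      using supersolvable_join_closure.join by blast
  qed
next
  fix M :: "'a matroid"
  assume "M \<in> supersolvable_join_closure"
  then show "M \<in> ME"
    by induction (blast intro: supersolvable_in_ME ME.join)+
qed

end
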